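(* Let $(\mathcal{R},\partial,\int)$ be an integro-differential ring. Then, by repeatedly applying the twelve rewrite rules listed in the context in any order, every element of the ring of integro-differential operators $\mathcal{R}\langle\partial,\int,\mathrm{E}\rangle$ can be written as a sum of expressions of the form $$\textstyle f\cdot\partial^j,\quad f\cdot\int\cdot g,\quad f\cdot\mathrm{E}\cdot g\cdot\partial^j,\quad\text{or}\quad f\cdot\mathrm{E}\cdot h\cdot\int\cdot g$$ where $j\in\mathbb{N}_0$, $f,g\in\mathcal{R}$, and $h\in\int\mathcal{R}$.
   Context: Rings are unital, nonzero, not necessarily commutative, of arbitrary characteristic. A derivation on a ring $\mathcal{R}$ is an additive map $\partial$ with $\partial(fg)=(\partial f)g+f\,\partial g$; $\mathcal{C}=\{f\in\mathcal{R}:\partial f=0\}$ is the ring of constants. "$\mathcal{C}$-linear" means homomorphism of $\mathcal{C}$-bimodules. An integro-differential ring $(\mathcal{R},\partial,\int)$ is a differential ring together with a $\mathcal{C}$-linear map $\int\colon\mathcal{R}\to\mathcal{R}$ satisfying $\partial\int f=f$ for all $f$. Its induced evaluation is $\mathrm{E}f:=f-\int\partial f\in\mathcal{C}$. The ring of integro-differential operators $\mathcal{R}\langle\partial,\int,\mathrm{E}\rangle$ is the (noncommutative unital) ring extension of $\mathcal{R}$ generated by indeterminates $\partial,\int,\mathrm{E}$ that commute with all elements of $\mathcal{C}$, subject to the identities, for all $f\in\mathcal{R}$: $\partial\cdot f=f\cdot\partial+\partial f$, $\ \partial\cdot\int=1$, $\ \int\cdot\partial=1-\mathrm{E}$, $\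 \partial\cdot f\cdot\mathrm{E}=\partial f\cdot\mathrm{E}$, $\ \int\cdot f\cdot\mathrm{E}=\int f\cdot\mathrm{E}$, $\ \mathrm{E}\cdot f\cdot\mathrm{E}=\mathrm{E}f\cdot\mathrm{E}$. Here the dot denotes multiplication of operators, whereas $\partial f,\int f,\mathrm{E}f$ without dot denote elements of $\mathcal{R}$. The rewrite rules (replace the left-hand side, whenever it occurs in an expression of an operator, by the right-hand side; $f\in\mathcal{R}$ arbitrary; all are valid identities in $\mathcal{R}\langle\partial,\int,\mathrm{E}\rangle$) are: $\partial\cdot f=f\cdot\partial+\partial f$; $\partial\cdot\mathrm{E}=0$; $\partial\cdot\int=1$; $\mathrm{E}\cdot f\cdot\mathrm{E}=\mathrm{E}f\cdot\mathrm{E}$; $\mathrm{E}\cdot\mathrm{E}=\mathrm{E}$; $\mathrm{E}\cdot\int=0$; $\int\cdot f\cdot\partial=f-\mathrm{E}\cdot f-\int\cdot\partial f$; $\int\cdot f\cdot\mathrm{E}=\int f\cdot\mathrm{E}$; $\int\cdot f\cdot\int=\int f\cdot\int-\int\cdot\int f-\mathrm{E}\cdot\int f\cdot\int$; $\int\cdot\partial=1-\mathrm{E}$; $\int\cdot\mathrm{E}=\int1\cdot\mathrm{E}$; $\int\cdot\int=\int1\cdot\int-\int\cdot\int1-\mathrm{E}\cdot\int1\cdot\int$. *)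

theory Defs
  imports "HOL-Library.Poly_Mapping" "HOL-Algebra.QuotRing"
begin

section \<open>Integro-differential rings\<close>

text \<open>A ring is a type of class \<^class>\<open>ring_1\<close>: unital, nonzero, not necessarily commutative, of
  arbitrary characteristic.\<close>

definition constants :: "('a::ring_1 \<Rightarrow> 'a) \<Rightarrow> 'a set" where
  "constants d = {f. d f = 0}"

locale differential_ring =
  fixes d :: "'a::ring_1 \<Rightarrow> 'a"
  assumes deriv_add: "d (f + g) = d f + d g"
    and deriv_mult: "d (f * g) = d f * g + f * d g"

locale integro_differential_ring = differential_ring d
  for d :: "'a::ring_1 \<Rightarrow> 'a" +
  fixes J :: "'a \<Rightarrow> 'a"
  assumes int_add: "J (f + g) = J f + J g"
    and int_const_left: "c \<in> constants d \<Longrightarrow> J (c * f) = c * J f"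
    and int_const_right: "c \<in> constants d \<Longrightarrow> J (f * c) = J f * c"
    and deriv_int: "d (J f) = f"

definition evaluation :: "('a::ring_1 \<Rightarrow> 'a) \<Rightarrow> ('a \<Rightarrow> 'a) \<Rightarrow> 'a \<Rightarrow> 'a" where
  "evaluation d J f = f - J (d f)"


section \<open>Expressions of operators\<close>

text \<open>An expression is an element of the free ring on the letters \<^term>\<open>Coef f\<close>
  (one letter for every ring element \<open>f\<close>), \<^term>\<open>Diff\<close>, \<^term>\<open>Integ\<close>, and \<^term>\<open>Eval\<close>, that is,
  a formal integer combination of words. The free ring is the monoid ring over the free monoid of
  words, whose operation is concatenation, written additively to fit \<^theory>\<open>HOL-Library.Poly_Mapping\<close>.\<close>

datatype 'a letter = Coef 'a | Diff | Integ | Eval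

datatype 'a op_word = Word "'a letter list"

instantiation op_word :: (type) monoid_add
begin

definition zero_op_word :: "'a op_word" where
  "0 = Word []"

fun plus_op_word :: "'a op_word \<Rightarrow> 'a op_word \<Rightarrow> 'a op_word" where
  "Word u + Word v = Word (u @ v)"

instance
proof
  fix a b c :: "'a op_word"
  show "a + b + c = a + (b + c)" by (cases a; cases b; cases c) simp
  show "0 + a = a" by (cases a) (simp add: zero_op_word_def)
  show "a + 0 = a" by (cases a) (simp add: zero_op_word_def)
qed

end

type_synonym 'a op_expr = "'a op_word \<Rightarrow>\<^sub>0 int"

definition mon :: "'a op_word \<Rightarrow> 'a op_expr" where
  "mon w = Poly_Mapping.single w 1"

definition coef :: "'a \<Rightarrow> 'a op_expr" where
  "coef f = mon (Word [Coef f])"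

definition diff_op :: "'a op_expr" where
  "diff_op = mon (Word [Diff])"

definition int_op :: "'a op_expr" where
  "int_op = mon (Word [Integ])"

definition eval_op :: "'a op_expr" where
  "eval_op = mon (Word [Eval])"

definition free_op_ring :: "'a op_expr ring" where
  "free_op_ring = \<lparr>carrier = UNIV, mult = (*), one = 1, zero = 0, add = (+)\<rparr>"


section \<open>The ring of integro-differential operators\<close>

text \<open>The coefficient relations express that the letters \<^term>\<open>Coef f\<close> form a homomorphic
  image of the given ring and that the three indeterminates commute with the constants. Modulo these
  relations alone, one obtains the ring extension freely generated by indeterminates commuting with
  the constants.\<close>

inductive_set coef_relations :: "('a::ring_1 \<Rightarrow> 'a) \<Rightarrow> 'a op_expr set" for d where
  "coef (f + g) - (coef f + coef g) \<in> coef_relations d"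
| "coef (f * g) - coef f * coef g \<in> coef_relations d"
| "coef 1 - 1 \<in> coef_relations d"
| "c \<in> constants d \<Longrightarrow> diff_op * coef c - coef c * diff_op \<in> coef_relations d"
| "c \<in> constants d \<Longrightarrow> int_op * coef c - coef c * int_op \<in> coef_relations d"
| "c \<in> constants d \<Longrightarrow> eval_op * coef c - coef c * eval_op \<in> coef_relations d"

inductive_set op_relations ::
  "('a::ring_1 \<Rightarrow> 'a) \<Rightarrow> ('a \<Rightarrow> 'a) \<Rightarrow> 'a op_expr set" for d J where
  "diff_op * coef f - (coef f * diff_op + coef (d f)) \<in> op_relations d J"
| "diff_op * int_op - 1 \<in> op_relations d J"
| "int_op * diff_op - (1 - eval_op) \<in> op_relations d J"
| "diff_op * coef f * eval_op - coef (d f) * eval_op \<in> op_relations d J"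
| "int_op * coef f * eval_op - coef (J f) * eval_op \<in> op_relations d J"
| "eval_op * coef f * eval_op - coef (evaluation d J f) * eval_op \<in> op_relations d J"

definition ido_ideal ::
  "('a::ring_1 \<Rightarrow> 'a) \<Rightarrow> ('a \<Rightarrow> 'a) \<Rightarrow> 'a op_expr set" where
  "ido_ideal d J = Idl\<^bsub>free_op_ring\<^esub> (coef_relations d \<union> op_relations d J)"

definition ido_ring ::
  "('a::ring_1 \<Rightarrow> 'a) \<Rightarrow> ('a \<Rightarrow> 'a) \<Rightarrow> 'a op_expr set ring" where
  "ido_ring d J = free_op_ring Quot ido_ideal d J"

text \<open>The operator denoted by an expression.\<close>

definition ido_class ::
  "('a::ring_1 \<Rightarrow> 'a) \<Rightarrow> ('a \<Rightarrow> 'a) \<Rightarrow> 'a op_expr \<Rightarrow> 'a op_expr set" where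
  "ido_class d J x = ido_ideal d J +>\<^bsub>free_op_ring\<^esub> x"

text \<open>Equality of expressions up to calculations with coefficients, without using any of the
  identities for differentiation, integration, and evaluation.\<close>

definition coef_equal :: "('a::ring_1 \<Rightarrow> 'a) \<Rightarrow> 'a op_expr \<Rightarrow> 'a op_expr \<Rightarrow> bool" where
  "coef_equal d x y \<longleftrightarrow> x - y \<in> Idl\<^bsub>free_op_ring\<^esub> (coef_relations d)"


section \<open>Rewriting\<close>

inductive_set op_rules ::
  "('a::ring_1 \<Rightarrow> 'a) \<Rightarrow> ('a \<Rightarrow> 'a) \<Rightarrow> ('a op_word \<times> 'a op_expr) set" for d J where
  diff_coef: "(Word [Diff, Coef f], coef f * diff_op + coef (d f)) \<in> op_rules d J"
| diff_eval: "(Word [Diff, Eval], 0) \<in> op_rules d J"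
| diff_int: "(Word [Diff, Integ], 1) \<in> op_rules d J"
| eval_coef_eval:
    "(Word [Eval, Coef f, Eval], coef (evaluation d J f) * eval_op) \<in> op_rules d J"
| eval_eval: "(Word [Eval, Eval], eval_op) \<in> op_rules d J"
| eval_int: "(Word [Eval, Integ], 0) \<in> op_rules d J"
| int_coef_diff:
    "(Word [Integ, Coef f, Diff], coef f - eval_op * coef f - int_op * coef (d f))
      \<in> op_rules d J"
| int_coef_eval: "(Word [Integ, Coef f, Eval], coef (J f) * eval_op) \<in> op_rules d J"
| int_coef_int:
    "(Word [Integ, Coef f, Integ],
      coef (J f) * int_op - int_op * coef (J f) - eval_op * coef (J f) * int_op)
      \<in> op_rules d J"
| int_diff: "(Word [Integ, Diff], 1 - eval_op) \<in> op_rules d J"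
| int_eval: "(Word [Integ, Eval], coef (J 1) * eval_op) \<in> op_rules d J"
| int_int:
    "(Word [Integ, Integ],
      coef (J 1) * int_op - int_op * coef (J 1) - eval_op * coef (J 1) * int_op)
      \<in> op_rules d J"

text \<open>Multiplying out adjacent coefficients, which is implicit in the usual notation, where
  adjacent coefficients always denote their product in the given ring. Without it, for
  instance, no rule applies to \<open>\<integral>\<cdot>f\<cdot>g\<cdot>\<partial>\<close> as a word in four letters.\<close>

inductive_set coef_rules :: "('a::ring_1 op_word \<times> 'a op_expr) set" where
  "(Word [Coef f, Coef g], coef (f * g)) \<in> coef_rules"
| "(Word [Coef 1], 1) \<in> coef_rules"

text \<open>A rewrite step selects a word \<open>u + l + v\<close> that occurs in the expression (with a nonzero
  integer factor) and contains the left-hand side \<open>l\<close> of a rule, and replaces this occurrence of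
  \<open>l\<close> by the right-hand side \<open>r\<close>.\<close>

definition rewrite_step ::
  "('a op_word \<times> 'a op_expr) set \<Rightarrow> 'a op_expr \<Rightarrow> 'a op_expr \<Rightarrow> bool" where
  "rewrite_step S x y \<longleftrightarrow>
    (\<exists>u l r v. (l, r) \<in> S \<and> Poly_Mapping.lookup x (u + l + v) \<noteq> 0 \<and>
      y = x - of_int (Poly_Mapping.lookup x (u + l + v)) *
        (mon (u + l + v) - mon u * r * mon v))"

definition irreducible_expr :: "('a op_word \<times> 'a op_expr) set \<Rightarrow> 'a op_expr \<Rightarrow> bool" where
  "irreducible_expr S x \<longleftrightarrow> (\<nexists>y. rewrite_step S x y)"

inductive_set normal_terms ::
  "('a::ring_1 \<Rightarrow> 'a) \<Rightarrow> 'a op_expr set" for J where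
  "coef f * diff_op ^ j \<in> normal_terms J"
| "coef f * int_op * coef g \<in> normal_terms J"
| "coef f * eval_op * coef g * diff_op ^ j \<in> normal_terms J"
| "h \<in> range J \<Longrightarrow> coef f * eval_op * coef h * int_op * coef g \<in> normal_terms J"

end

theory Submission
  imports Defs "HOL-Library.Multiset"
begin

text \<open>Give every word the weight obtained by applying, from right to left and starting at 1, the map
  \<open>x \<mapsto> 2 x\<close> for each \<open>\<partial>\<close>, \<open>x \<mapsto> x + 3\<close> for each \<open>\<integral>\<close>, and \<open>x \<mapsto> x + 1\<close> for each coefficient
  and each \<open>E\<close>. Each rule replaces its left-hand side by words of smaller weight, in any context, so
  rewriting terminates by the multiset order. In an irreducible word only \<open>\<partial>\<close> may follow \<open>\<partial>\<close>, and
  at most a single coefficient may follow \<open>\<integral>\<close>, which leaves the words listed in the theorem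
  except that \<open>h\<close> in \<open>f\<cdot>E\<cdot>h\<cdot>\<integral>\<cdot>g\<close> is arbitrary. Writing \<open>h = \<integral>\<partial>h + Eh\<close> and moving the
  constant \<open>Eh\<close> to the left of \<open>E\<close> produces \<open>E\<cdot>\<integral>\<close>, which is rewritten to 0.\<close>

section \<open>Expressions and ideals\<close>

abbreviation words :: "'a op_expr \<Rightarrow> 'a op_word set" where
  "words \<equiv> Poly_Mapping.keys"

lemma mon_mult: "mon u * mon v = mon (u + v)"
  by (simp add: mon_def mult_single)

lemma mon_zero: "mon 0 = 1"
  by (simp add: mon_def)

text \<open>An integer is the multiple \<open>single 0 n\<close> of the empty word. With this, the
  subtraction in \<open>rewrite_step\<close> becomes the deletion of a single word.\<close>

lemma of_int_mult_mon: "of_int n * mon w = Poly_Mapping.single w n"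
proof -
  have "(of_int n :: 'a op_expr) = Poly_Mapping.single 0 n"
    by (metis single_of_int of_int_eq_id id_apply)
  then show ?thesis
    by (simp add: mon_def mult_single)
qed

lemma keys_mon: "words (mon w) = {w}"
  by (simp add: mon_def)

lemma diff_op_power: "diff_op ^ j = mon (Word (replicate j Diff))"
  by (induction j) (simp_all add: diff_op_def mon_mult mon_zero flip: zero_op_word_def)

lemmas op_defs = coef_def diff_op_def int_op_def eval_op_def

section \<open>The ring of expressions and congruence modulo its ideals\<close>

lemma ring_free_op_ring: "ring (free_op_ring :: 'a op_expr ring)"
proof (rule ringI)
  show "abelian_group (free_op_ring :: 'a op_expr ring)"
  proof (rule abelian_groupI)
    fix x :: "'a op_expr"
    show "\<exists>y\<in>carrier free_op_ring. y \<oplus>\<^bsub>free_op_ring\<^esub> x = \<zero>\<^bsub>free_op_ring\<^esub>"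
      by (rule bexI[of _ "- x"]) (simp_all add: free_op_ring_def)
  qed (simp_all add: free_op_ring_def algebra_simps)
  show "monoid (free_op_ring :: 'a op_expr ring)"
    by (rule monoidI) (simp_all add: free_op_ring_def algebra_simps)
qed (simp_all add: free_op_ring_def algebra_simps)

lemma ideal_Idl: "ideal (Idl\<^bsub>free_op_ring\<^esub> S) (free_op_ring :: 'a op_expr ring)"
  by (rule ring.genideal_ideal[OF ring_free_op_ring]) (simp add: free_op_ring_def)

lemma Idl_incl: "S \<subseteq> Idl\<^bsub>free_op_ring\<^esub> (S :: 'a op_expr set)"
  by (rule ring.genideal_self[OF ring_free_op_ring]) (simp add: free_op_ring_def)

text \<open>Instantiated with two ideals: the one generated by all relations, which governs equality
  of operators, and the one generated by the coefficient relations alone, which governs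
  \<open>coef_equal\<close>.\<close>

locale expr_ideal =
  fixes I :: "'a op_expr set"
  assumes ideal: "ideal I free_op_ring"
begin

lemma mult_left: "x \<in> I \<Longrightarrow> y * x \<in> I"
  using ideal.I_l_closed[OF ideal, of x y] by (simp add: free_op_ring_def)

lemma mult_right: "x \<in> I \<Longrightarrow> x * y \<in> I"
  using ideal.I_r_closed[OF ideal, of x y] by (simp add: free_op_ring_def)

lemma add: "x \<in> I \<Longrightarrow> y \<in> I \<Longrightarrow> x + y \<in> I"
  using additive_subgroup.a_closed[OF ideal.axioms(1)[OF ideal], of x y]
  by (simp add: free_op_ring_def)

lemma zero: "0 \<in> I"
  using additive_subgroup.zero_closed[OF ideal.axioms(1)[OF ideal]]
  by (simp add: free_op_ring_def)

lemma uminus: "x \<in> I \<Longrightarrow> - x \<in> I"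
  using mult_left[of x "- 1"] by simp

lemma diff: "x \<in> I \<Longrightarrow> y \<in> I \<Longrightarrow> x - y \<in> I"
  using add[of x "- y"] uminus by simp

definition cong :: "'a op_expr \<Rightarrow> 'a op_expr \<Rightarrow> bool"  (infix "\<approx>" 50)
  where "x \<approx> y \<longleftrightarrow> x - y \<in> I"

lemma cong_refl [simp]: "x \<approx> x"
  by (simp add: cong_def zero)

lemma cong_sym: "x \<approx> y \<Longrightarrow> y \<approx> x"
  using uminus[of "x - y"] by (simp add: cong_def)

lemma cong_trans [trans]: "x \<approx> y \<Longrightarrow> y \<approx> z \<Longrightarrow> x \<approx> z"
  using add[of "x - y" "y - z"] by (simp add: cong_def)

lemma cong_add: "x \<approx> y \<Longrightarrow> x' \<approx> y' \<Longrightarrow> x + x' \<approx> y + y'"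
  using add[of "x - y" "x' - y'"] by (simp add: cong_def algebra_simps)

lemma cong_mult: "x \<approx> y \<Longrightarrow> x' \<approx> y' \<Longrightarrow> x * x' \<approx> y * y'"
  using add[OF mult_right[of "x - y" x'] mult_left[of "x' - y'" y]]
  by (simp add: cong_def algebra_simps)

text \<open>A step subtracts an integer multiple of \<open>mon u * (mon l - r) * mon v\<close>,
  which lies in the two-sided ideal as soon as \<open>mon l - r\<close> does.\<close>

lemma rewrite_step_cong:
  assumes "rewrite_step S x y" and rules: "\<And>l r. (l, r) \<in> S \<Longrightarrow> mon l \<approx> r"
  shows "x \<approx> y"
proof -
  obtain u l r v where "(l, r) \<in> S"
    and y: "y = x - of_int (Poly_Mapping.lookup x (u + l + v)) *
      (mon (u + l + v) - mon u * r * mon v)"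
    using assms(1) unfolding rewrite_step_def by blast
  then have "of_int (Poly_Mapping.lookup x (u + l + v)) * (mon u * (mon l - r) * mon v) \<in> I"
    using rules by (simp add: cong_def mult_left mult_right)
  then show ?thesis
    unfolding cong_def y by (simp add: algebra_simps mon_mult)
qed

lemma rewrite_steps_cong:
  assumes "(rewrite_step S)\<^sup>*\<^sup>* x y" and "\<And>l r. (l, r) \<in> S \<Longrightarrow> mon l \<approx> r"
  shows "x \<approx> y"
  using assms(1)
proof induction
  case (step y z)
  then show ?case
    using rewrite_step_cong assms(2) cong_trans by blast
qed simp

lemma rcoset_eq: "x \<approx> y \<Longrightarrow> I +>\<^bsub>free_op_ring\<^esub> x = I +>\<^bsub>free_op_ring\<^esub> y"
proof -
  have "I +>\<^bsub>free_op_ring\<^esub> x \<subseteq> I +>\<^bsub>free_op_ring\<^esub> y" if "x \<approx> y" for x y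
  proof
    fix z assume "z \<in> I +>\<^bsub>free_op_ring\<^esub> x"
    then obtain i where "i \<in> I" "z = i + x"
      by (auto simp: a_r_coset_def' free_op_ring_def)
    then have "i + (x - y) \<in> I" "z = (i + (x - y)) + y"
      using that by (auto simp: cong_def intro: add)
    then have "\<exists>h\<in>I. z = h + y"
      by blast
    then show "z \<in> I +>\<^bsub>free_op_ring\<^esub> y"
      by (simp add: a_r_coset_def' free_op_ring_def)
  qed
  then show "x \<approx> y \<Longrightarrow> ?thesis"
    using cong_sym by blast
qed

end


lemma expr_ideal_Idl: "expr_ideal (Idl\<^bsub>free_op_ring\<^esub> S)"
  by (rule expr_ideal.intro[OF ideal_Idl])


section \<open>Validity of the rules\<close>

context integro_differential_ring
begin

interpretation ido: expr_ideal "ido_ideal d J"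
  unfolding ido_ideal_def by (rule expr_ideal_Idl)

lemma coef_relations_ido: "x \<in> coef_relations d \<Longrightarrow> x \<in> ido_ideal d J"
  and op_relations_ido: "x \<in> op_relations d J \<Longrightarrow> x \<in> ido_ideal d J"
  using Idl_incl[of "coef_relations d \<union> op_relations d J"] by (auto simp: ido_ideal_def)

text \<open>Ensures that calculations with coefficients leave the denoted operator
  unchanged.\<close>

lemma coef_ideal_ido: "Idl\<^bsub>free_op_ring\<^esub> (coef_relations d) \<subseteq> ido_ideal d J"
  by (rule ring.genideal_minimal[OF ring_free_op_ring ido.ideal]) (auto intro: coef_relations_ido)

text \<open>Evaluate \<integral>\<cdot>\<partial>\<cdot>\<integral> in two ways, starting with
  either adjacent pair. The identities below that are not defining relations arise from similar
  overlaps or by inserting the coefficient 1.\<close>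

lemma eval_int_ido: "eval_op * int_op \<in> ido_ideal d J"
proof -
  have "(int_op * diff_op - (1 - eval_op)) * int_op - int_op * (diff_op * int_op - 1)
      \<in> ido_ideal d J"
    by (intro ido.diff ido.mult_left ido.mult_right op_relations_ido op_relations.intros)
  then show ?thesis
    by (simp add: algebra_simps)
qed

lemma diff_eval_ido: "diff_op * eval_op \<in> ido_ideal d J"
proof -
  have "diff_op * (int_op * diff_op - (1 - eval_op)) - (diff_op * int_op - 1) * diff_op
      \<in> ido_ideal d J"
    by (intro ido.diff ido.mult_left ido.mult_right op_relations_ido op_relations.intros)
  then show ?thesis
    by (simp add: algebra_simps)
qed

lemma eval_eval_ido: "eval_op * eval_op - eval_op \<in> ido_ideal d J"
proof -
  have "(int_op * diff_op - (1 - eval_op)) * eval_op - int_op * (diff_op * eval_op)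
      \<in> ido_ideal d J"
    by (intro ido.diff ido.mult_left ido.mult_right op_relations_ido op_relations.intros
        diff_eval_ido)
  then show ?thesis
    by (simp add: algebra_simps)
qed

text \<open>Integration by parts, from the overlap \<integral>\<cdot>\<partial>\<cdot>f of the rule
  for \<integral>\<cdot>\<partial> with the Leibniz rule.\<close>

lemma int_coef_diff_ido:
  "int_op * coef f * diff_op - (coef f - eval_op * coef f - int_op * coef (d f)) \<in> ido_ideal d J"
proof -
  have "(int_op * diff_op - (1 - eval_op)) * coef f
      - int_op * (diff_op * coef f - (coef f * diff_op + coef (d f))) \<in> ido_ideal d J"
    by (intro ido.diff ido.mult_left ido.mult_right op_relations_ido op_relations.intros)
  then show ?thesis
    by (simp add: algebra_simps)
qed

text \<open>Integration by parts for the coefficient \<open>J f\<close>, multiplied by \<integral>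
  from the right; then \<partial>\<cdot>\<integral> cancels and \<open>d (J f) = f\<close>.\<close>

lemma int_coef_int_ido:
  "int_op * coef f * int_op
    - (coef (J f) * int_op - int_op * coef (J f) - eval_op * coef (J f) * int_op) \<in> ido_ideal d J"
proof -
  have "(int_op * coef (J f) * diff_op
        - (coef (J f) - eval_op * coef (J f) - int_op * coef (d (J f)))) * int_op
      - (int_op * coef (J f)) * (diff_op * int_op - 1) \<in> ido_ideal d J"
    by (intro ido.diff ido.mult_left ido.mult_right op_relations_ido op_relations.intros
        int_coef_diff_ido)
  then show ?thesis
    by (simp add: algebra_simps deriv_int)
qed

lemma int_eval_ido: "int_op * eval_op - coef (J 1) * eval_op \<in> ido_ideal d J"
proof -
  have "int_op * coef 1 * eval_op - coef (J 1) * eval_op - int_op * (coef 1 - 1) * eval_op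
      \<in> ido_ideal d J"
    by (intro ido.diff ido.mult_left ido.mult_right op_relations_ido op_relations.intros
        coef_relations_ido coef_relations.intros)
  then show ?thesis
    by (simp add: algebra_simps)
qed

lemma int_int_ido:
  "int_op * int_op
    - (coef (J 1) * int_op - int_op * coef (J 1) - eval_op * coef (J 1) * int_op) \<in> ido_ideal d J"
proof -
  have "int_op * coef 1 * int_op
      - (coef (J 1) * int_op - int_op * coef (J 1) - eval_op * coef (J 1) * int_op)
      - int_op * (coef 1 - 1) * int_op \<in> ido_ideal d J"
    by (intro ido.diff ido.mult_left ido.mult_right int_coef_int_ido
        coef_relations_ido coef_relations.intros)
  then show ?thesis
    by (simp add: algebra_simps)
qed

text \<open>At least two letters are required on the left, so that as a simplification rule it stops
  at single letters.\<close>

lemma mon_Word_Cons: "mon (Word (a # b # w)) = mon (Word [a]) * mon (Word (b # w))"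
  by (simp add: mon_mult)

lemma op_rules_ido: "(l, r) \<in> op_rules d J \<Longrightarrow> mon l - r \<in> ido_ideal d J"
proof (induction l r rule: op_rules.induct)
  case (diff_coef f)
  show ?case
    using op_relations_ido[OF op_relations.intros(1)]
    by (simp add: mon_Word_Cons mult.assoc flip: op_defs)
next
  case diff_eval
  show ?case
    using diff_eval_ido by (simp add: mon_Word_Cons mult.assoc flip: op_defs)
next
  case diff_int
  show ?case
    using op_relations_ido[OF op_relations.intros(2)]
    by (simp add: mon_Word_Cons mult.assoc flip: op_defs)
next
  case (eval_coef_eval f)
  show ?case
    using op_relations_ido[OF op_relations.intros(6)]
    by (simp add: mon_Word_Cons mult.assoc flip: op_defs)
next
  case eval_eval
  show ?case
    using eval_eval_ido by (simp add: mon_Word_Cons mult.assoc flip: op_defs)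
next
  case eval_int
  show ?case
    using eval_int_ido by (simp add: mon_Word_Cons mult.assoc flip: op_defs)
next
  case (int_coef_diff f)
  show ?case
    using int_coef_diff_ido by (simp add: mon_Word_Cons mult.assoc flip: op_defs)
next
  case (int_coef_eval f)
  show ?case
    using op_relations_ido[OF op_relations.intros(5)]
    by (simp add: mon_Word_Cons mult.assoc flip: op_defs)
next
  case (int_coef_int f)
  show ?case
    using int_coef_int_ido by (simp add: mon_Word_Cons mult.assoc flip: op_defs)
next
  case int_diff
  show ?case
    using op_relations_ido[OF op_relations.intros(3)]
    by (simp add: mon_Word_Cons mult.assoc flip: op_defs)
next
  case int_eval
  show ?case
    using int_eval_ido by (simp add: mon_Word_Cons mult.assoc flip: op_defs)
next
  case int_int
  show ?case
    using int_int_ido by (simp add: mon_Word_Cons mult.assoc flip: op_defs)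
qed

lemma coef_rules_ido: "(l, r) \<in> coef_rules \<Longrightarrow> mon l - r \<in> ido_ideal d J"
proof (induction l r rule: coef_rules.induct)
  case (1 f g)
  have "- (coef (f * g) - coef f * coef g) \<in> ido_ideal d J"
    by (intro ido.uminus coef_relations_ido coef_relations.intros)
  then show ?case
    by (simp add: mon_Word_Cons flip: op_defs)
next
  case 2
  show ?case
    using coef_relations_ido[OF coef_relations.intros(3)] by (simp flip: op_defs)
qed

end


section \<open>Termination\<close>

text \<open>Doubling at \<partial> pays for moving a coefficient to its left: 2(x + 1) exceeds 2x +
  1. The increment 3 at \<integral> is the least that makes \<integral>\<cdot>\<integral> heavier
  than E\<cdot>f\<cdot>\<integral>: x + 6 against x + 5.\<close>

fun letter_weight :: "'a letter \<Rightarrow> nat \<Rightarrow> nat" where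
  "letter_weight (Coef f) x = x + 1"
| "letter_weight Diff x = 2 * x"
| "letter_weight Integ x = x + 3"
| "letter_weight Eval x = x + 1"

fun word_weight :: "'a op_word \<Rightarrow> nat \<Rightarrow> nat" where
  "word_weight (Word w) x = foldr letter_weight w x"

lemma word_weight_add: "word_weight (u + v) x = word_weight u (word_weight v x)"
  by (cases u; cases v) simp

lemma word_weight_mono: "x < y \<Longrightarrow> word_weight w x < word_weight w y"
proof (cases w)
  case (Word ls)
  have "letter_weight a x < letter_weight a y" if "x < y" for a :: "'a letter" and x y
    using that by (cases a) auto
  then have "x < y \<Longrightarrow> foldr letter_weight ls x < foldr letter_weight ls y"
    by (induction ls) auto
  then show "x < y \<Longrightarrow> ?thesis"
    using Word by simp
qed

lemma word_weight_pos: "1 \<le> x \<Longrightarrow> 1 \<le> word_weight w x"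
proof (cases w)
  case (Word ls)
  have "1 \<le> letter_weight a x" if "1 \<le> x" for a :: "'a letter" and x
    using that by (cases a) auto
  then have "1 \<le> x \<Longrightarrow> 1 \<le> foldr letter_weight ls x"
    by (induction ls) auto
  then show "1 \<le> x \<Longrightarrow> ?thesis"
    using Word by simp
qed

text \<open>The variable \<open>x\<close> stands for the weight of an arbitrary right context. The
  bound \<open>x \<ge> 1\<close> matters: at 0 the words \<integral>\<cdot>f\<cdot>\<partial> and
  \<integral>\<cdot>g would both have weight 4. Left contexts are handled by
  \<open>word_weight_mono\<close>.\<close>

definition decreasing :: "('a op_word \<times> 'a op_expr) set \<Rightarrow> bool" where
  "decreasing S \<longleftrightarrow>
    (\<forall>(l, r) \<in> S. \<forall>k \<in> words r. \<forall>x \<ge> 1. word_weight k x < word_weight l x)"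

lemma keys_mult_mon: "words (mon u * r * mon v) \<subseteq> {u + k + v |k. k \<in> words r}"
  using keys_mult[of "mon u * r" "mon v"] keys_mult[of "mon u" r]
  by (fastforce simp: keys_mon)

text \<open>The rewritten word disappears from the support, and any word that newly appears comes
  from the replacement and is lighter. Words common to both supports stay put, so the multiset order
  applies.\<close>

lemma rewrite_step_decreases:
  assumes "decreasing S" and "rewrite_step S x y"
  shows "(mset_set (words y), mset_set (words x)) \<in> mult (measure (\<lambda>w. word_weight w 1))"
proof -
  obtain u l r v where lr: "(l, r) \<in> S" and nz: "Poly_Mapping.lookup x (u + l + v) \<noteq> 0"
    and y: "y = x - of_int (Poly_Mapping.lookup x (u + l + v)) *
      (mon (u + l + v) - mon u * r * mon v)"
    using assms(2) unfolding rewrite_step_def by blast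
  define w where "w = u + l + v"
  define n where "n = Poly_Mapping.lookup x w"
  define z where "z = mon u * r * mon v"
  have less: "word_weight k 1 < word_weight w 1" if k: "k \<in> words z" for k
  proof -
    obtain m where "m \<in> words r" "k = u + m + v"
      using k keys_mult_mon[of u r v] unfolding z_def by blast
    moreover have "word_weight m (word_weight v 1) < word_weight l (word_weight v 1)"
      using assms(1) lr \<open>m \<in> words r\<close> word_weight_pos[of 1 v] by (fastforce simp: decreasing_def)
    ultimately show ?thesis
      by (simp add: w_def word_weight_add word_weight_mono)
  qed
  have y_eq: "y = x - Poly_Mapping.single w n + of_int n * z"
    unfolding y w_def[symmetric] n_def[symmetric] z_def[symmetric]
    by (simp add: right_diff_distrib of_int_mult_mon)
  \<comment> \<open>In this form the integer factor visibly has at most the empty word in its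
    support, so multiplying by it creates no new words.\<close>
  have "(of_int n :: 'a op_expr) = of_int n * mon 0"
    by (simp add: mon_zero)
  then have keys_nz: "words (of_int n * z) \<subseteq> words z"
    using keys_mult[of "of_int n" z] by (auto simp: of_int_mult_mon split: if_splits)
  \<comment> \<open>All words of \<open>z\<close> are strictly lighter than \<open>w\<close>, so the
    replacement cannot reintroduce \<open>w\<close>.\<close>
  have "Poly_Mapping.lookup (of_int n * z) w = 0"
    using keys_nz less by (metis in_keys_iff less_irrefl subsetD)
  then have "w \<notin> words y"
    by (simp add: y_eq in_keys_iff lookup_add lookup_minus n_def)
  moreover have "w \<in> words x"
    using nz by (simp add: w_def in_keys_iff)
  moreover have "k \<in> words x \<or> k \<in> words z" if "k \<in> words y" for k
  proof (rule ccontr)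
    assume *: "\<not> (k \<in> words x \<or> k \<in> words z)"
    then have "Poly_Mapping.lookup (of_int n * z) k = 0" "k \<noteq> w"
      using keys_nz \<open>w \<in> words x\<close> by (auto simp: in_keys_iff)
    with * that show False
      by (simp add: y_eq in_keys_iff lookup_add lookup_minus lookup_single)
  qed
  ultimately have *: "w \<in> words x - words y"
    "\<forall>k \<in> words y - words x. word_weight k 1 < word_weight w 1"
    using less by auto
  have "(mset_set (words x \<inter> words y) + mset_set (words y - words x),
      mset_set (words x \<inter> words y) + mset_set (words x - words y))
      \<in> mult (measure (\<lambda>w. word_weight w 1))"
  proof (rule one_step_implies_mult)
    show "mset_set (words x - words y) \<noteq> {#}"
      using *(1) by (metis empty_iff finite_Diff finite_keys mset_set_empty_iff)
    show "\<forall>k \<in># mset_set (words y - words x). \<exists>j \<in># mset_set (words x - words y).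
        (k, j) \<in> measure (\<lambda>w. word_weight w 1)"
      using * by auto
  qed
  moreover have "mset_set (words x \<inter> words y) + mset_set (words x - words y) = mset_set (words x)"
    by (subst mset_set_Union[symmetric]) (auto intro: arg_cong[of _ _ mset_set])
  moreover have "mset_set (words x \<inter> words y) + mset_set (words y - words x) = mset_set (words y)"
    by (subst mset_set_Union[symmetric]) (auto intro: arg_cong[of _ _ mset_set])
  ultimately show ?thesis
    by simp
qed

section \<open>Well-foundedness and existence of irreducible results\<close>

lemma wf_rewrite_step:
  assumes "decreasing S"
  shows "wf {(y, x). rewrite_step S x y}"
proof (rule wf_subset)
  show "wf (inv_image (mult (measure (\<lambda>w. word_weight w 1))) (\<lambda>x. mset_set (words x)))"
    by (intro wf_inv_image wf_mult wf_measure)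
qed (use rewrite_step_decreases[OF assms] in auto)

lemma decreasing_rules: "decreasing (op_rules d J \<union> coef_rules)"
proof -
  \<comment> \<open>These split the support of a right-hand side into its individual words, leaving
    one linear inequality in \<open>x\<close> for each.\<close>
  have words_add: "k \<in> words (a + b) \<Longrightarrow> k \<in> words a \<or> k \<in> words b"
    and words_diff: "k \<in> words (a - b) \<Longrightarrow> k \<in> words a \<or> k \<in> words b"
    for k and a b :: "'a op_expr"
    using keys_add[of a b] keys_diff[of a b] by blast+
  have "word_weight k x < word_weight l x"
    if "(l, r) \<in> op_rules d J" "k \<in> words r" "x \<ge> 1" for l r k x
    using that
    by (cases rule: op_rules.cases)
      (auto dest!: words_add words_diff simp: op_defs mon_mult keys_mon zero_op_word_def)
  moreover have "word_weight k x < word_weight l x"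
    if "(l, r) \<in> coef_rules" "k \<in> words r" "x \<ge> 1" for l r k x
    using that by (cases rule: coef_rules.cases) (auto simp: coef_def keys_mon zero_op_word_def)
  ultimately have "word_weight k x < word_weight l x"
    if "(l, r) \<in> op_rules d J \<union> coef_rules" "k \<in> words r" "x \<ge> 1" for l r k x
    using that by blast
  then show ?thesis
    unfolding decreasing_def by blast
qed

lemma rewrite_normal_form:
  assumes "decreasing S"
  shows "\<exists>y. (rewrite_step S)\<^sup>*\<^sup>* x y \<and> irreducible_expr S y"
  using wf_rewrite_step[OF assms]
proof (induction x rule: wf_induct_rule)
  case (less x)
  then show ?case
    unfolding irreducible_expr_def
    by (metis (mono_tags, lifting) case_prod_conv converse_rtranclp_into_rtranclp mem_Collect_eq
        rtranclp.rtrancl_refl)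
qed


section \<open>Irreducible words\<close>

definition reduced :: "('a::ring_1 \<Rightarrow> 'a) \<Rightarrow> ('a \<Rightarrow> 'a) \<Rightarrow> 'a letter list \<Rightarrow> bool" where
  "reduced d J w \<longleftrightarrow> (\<forall>u l v r. w = u @ l @ v \<longrightarrow> (Word l, r) \<notin> op_rules d J \<union> coef_rules)"

lemma irreducible_exprD:
  assumes "irreducible_expr (op_rules d J \<union> coef_rules) y" and "Word w \<in> words y"
  shows "reduced d J w"
  unfolding reduced_def
proof (intro allI impI notI)
  fix u l v r
  assume "w = u @ l @ v" and "(Word l, r) \<in> op_rules d J \<union> coef_rules"
  moreover from this have "Poly_Mapping.lookup y (Word u + Word l + Word v) \<noteq> 0"
    using assms(2) by (simp add: in_keys_iff)
  ultimately show False
    using assms(1) unfolding irreducible_expr_def rewrite_step_def by blast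
qed

lemma reduced_Cons: "reduced d J (a # w) \<Longrightarrow> reduced d J w"
  unfolding reduced_def by (metis append_Cons)

lemma not_reduced_append: "(Word l, r) \<in> op_rules d J \<union> coef_rules \<Longrightarrow> \<not> reduced d J (l @ v)"
  unfolding reduced_def by (metis append_Nil)

text \<open>Left-hand sides are excluded only as prefixes; \<open>reduced_Cons\<close> strips
  letters from the left to reach the other positions.\<close>

lemmas not_reduced [simp] =
  op_rules.intros[THEN UnI1, THEN not_reduced_append, unfolded append.simps]
  coef_rules.intros(1)[THEN UnI2, THEN not_reduced_append, unfolded append.simps]

text \<open>A slot for at most one coefficient. The empty slot stands for the factor 1, which the
  terms in \<open>normal_terms\<close> spell out as a coefficient.\<close>

definition opt_coef :: "'a letter list set" where
  "opt_coef = insert [] (range (\<lambda>f. [Coef f]))"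

lemma reduced_Diff: "reduced d J (Diff # w) \<Longrightarrow> \<exists>j. w = replicate j Diff"
proof (induction w)
  case (Cons a w)
  then have "a = Diff"
    by (cases a) auto
  with Cons obtain j where "w = replicate j Diff"
    using reduced_Cons by blast
  with \<open>a = Diff\<close> have "a # w = replicate (Suc j) Diff"
    by simp
  then show ?case
    by blast
qed simp

text \<open>The two-letter rules forbid an operator letter right after \<integral>, the three-letter
  rules forbid one after \<integral>\<cdot>f, and adjacent coefficients would be multiplied
  out.\<close>

lemma reduced_Integ:
  assumes "reduced d J (Integ # w)"
  shows "w \<in> opt_coef"
proof (cases w)
  case (Cons a v)
  with assms obtain f where a: "a = Coef f"
    by (cases a) auto
  have "v = []"
  proof (cases v)
    case (Cons b v')
    then show ?thesis
      using assms \<open>w = a # v\<close> a reduced_Cons[of d J Integ w] by (cases b) auto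
  qed simp
  with Cons a show ?thesis
    by (simp add: opt_coef_def)
qed (simp add: opt_coef_def)

lemma reduced_Eval:
  assumes "reduced d J (Eval # w)"
  shows "(\<exists>c \<in> opt_coef. \<exists>j. w = c @ replicate j Diff) \<or>
    (\<exists>f. \<exists>c \<in> opt_coef. w = Coef f # Integ # c)"
proof -
  have Diff: "\<exists>j. w = replicate j Diff" if "reduced d J w" "w = [] \<or> hd w = Diff" for w
    using that by (metis reduced_Diff list.collapse replicate_Suc replicate_0)
  show ?thesis
  proof (cases "w = [] \<or> hd w = Diff")
    case True
    then show ?thesis
      using Diff[of w] reduced_Cons[OF assms] by (force simp: opt_coef_def)
  next
    case False
    then obtain f v where w: "w = Coef f # v"
      using assms by (cases w; cases "hd w") auto
    have v: "reduced d J (Coef f # v)" "reduced d J v"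
      using assms reduced_Cons w by blast+
    show ?thesis
    proof (cases "v = [] \<or> hd v = Diff")
      case True
      then obtain j where "w = [Coef f] @ replicate j Diff"
        using Diff[of v] v w by auto
      then show ?thesis
        by (auto simp: opt_coef_def)
    next
      case False
      \<comment> \<open>After E\<cdot>f another coefficient would merge with f and another E would
        be absorbed, so only \<integral> is left.\<close>
      then obtain v' where "v = Integ # v'"
        using assms v w by (cases v; cases "hd v") auto
      then show ?thesis
        using v reduced_Integ w by blast
    qed
  qed
qed

text \<open>Split off the leading coefficient, of which there is at most one, and distinguish the
  first operator letter.\<close>

lemma reduced_cases:
  assumes "reduced d J w"
  obtains (diff) c j where "c \<in> opt_coef" "w = c @ replicate j Diff"
  | (int) c c' where "c \<in> opt_coef" "c' \<in> opt_coef" "w = c @ Integ # c'"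
  | (eval) c c' j where "c \<in> opt_coef" "c' \<in> opt_coef" "w = c @ Eval # c' @ replicate j Diff"
  | (eval_int) c h c' where "c \<in> opt_coef" "c' \<in> opt_coef" "w = c @ Eval # Coef h # Integ # c'"
proof -
  obtain c v where w: "w = c @ v" and c: "c \<in> opt_coef" and "reduced d J v"
    and not_Coef: "\<And>f v'. v \<noteq> Coef f # v'"
  proof (cases "\<exists>f v. w = Coef f # v")
    case True
    then obtain f v where w: "w = Coef f # v"
      by blast
    have "v \<noteq> Coef g # v'" for g v'
      using assms w by auto
    then show ?thesis
      using that[of "[Coef f]" v] w assms reduced_Cons[of d J "Coef f" v]
      by (auto simp: opt_coef_def)
  next
    case False
    then show ?thesis
      using that[of "[]" w] assms by (auto simp: opt_coef_def)
  qed
  show ?thesis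
  proof (cases v)
    case Nil
    then show ?thesis
      \<comment> \<open>A word without operator letters counts as the case of \<partial> to the
        power 0.\<close>
      using diff[of c 0] c w by simp
  next
    case (Cons a v')
    show ?thesis
    proof (cases a)
      case (Coef f)
      then show ?thesis
        using not_Coef Cons by blast
    next
      case Diff
      then obtain j where "v' = replicate j Diff"
        using reduced_Diff \<open>reduced d J v\<close> Cons by blast
      then show ?thesis
        using diff[of c "Suc j"] c w Cons Diff by simp
    next
      case Integ
      then show ?thesis
        using int[of c v'] reduced_Integ \<open>reduced d J v\<close> Cons c w by blast
    next
      case Eval
      then show ?thesis
        using reduced_Eval[of d J v'] \<open>reduced d J v\<close> Cons c w eval eval_int by blast
    qed
  qed
qed


section \<open>Normal forms\<close>

text \<open>These are the words deleted by the rule E\<cdot>\<integral> = 0. Terms in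
  \<open>normal_terms\<close> avoid them, since there every \<integral> directly follows a
  coefficient.\<close>

definition eval_int_words :: "'a op_word set" where
  "eval_int_words = {u + Word [Eval, Integ] + v |u v. True}"

lemma Word_eval_int_words_iff:
  "Word w \<in> eval_int_words \<longleftrightarrow> (\<exists>u v. w = u @ Eval # Integ # v)"
proof
  assume "Word w \<in> eval_int_words"
  then obtain u v where "Word w = u + Word [Eval, Integ] + v"
    by (auto simp: eval_int_words_def)
  then show "\<exists>u v. w = u @ Eval # Integ # v"
    by (cases u; cases v) auto
next
  assume "\<exists>u v. w = u @ Eval # Integ # v"
  then obtain u v where "Word w = Word u + Word [Eval, Integ] + Word v"
    by auto
  then show "Word w \<in> eval_int_words"
    unfolding eval_int_words_def by blast
qed

lemma keys_normal_term:
  fixes J :: "'a::ring_1 \<Rightarrow> 'a"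
  assumes "t \<in> normal_terms J" and "k \<in> words t"
  shows "k \<notin> eval_int_words"
proof -
  have "replicate j (Diff :: 'a letter) \<noteq> u @ Eval # v" for j u v
    by (metis in_set_conv_decomp in_set_replicate letter.distinct(9))
  then show ?thesis
    using assms(2)
    by (cases rule: normal_terms.cases[OF assms(1)])
      (auto simp: op_defs diff_op_power[unfolded op_defs] mon_mult keys_mon
        Word_eval_int_words_iff Cons_eq_append_conv)
qed

lemma keys_sum_list_normal_terms:
  "set ts \<subseteq> normal_terms J \<Longrightarrow> words (sum_list ts) \<inter> eval_int_words = {}"
proof (induction ts)
  case (Cons t ts)
  then show ?case
    using keys_add[of t "sum_list ts"] keys_normal_term by fastforce
qed simp

text \<open>Induction on the number of words in \<open>z\<close>. Replacing E\<cdot>\<integral> by 0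
  deletes the whole word, and no word of \<open>s\<close> is affected because \<open>s\<close>
  contains none of this kind.\<close>

lemma rewrite_eval_int:
  assumes "words s \<inter> eval_int_words = {}" and "words z \<subseteq> eval_int_words"
  shows "(rewrite_step {(Word [Eval, Integ], 0)})\<^sup>*\<^sup>* (s + z) s"
  using assms(2)
proof (induction "card (words z)" arbitrary: z)
  case 0
  then show ?case
    by simp
next
  case (Suc n)
  then obtain w where w: "w \<in> words z"
    by fastforce
  then obtain u v where uv: "w = u + Word [Eval, Integ] + v"
    using Suc.prems by (auto simp: eval_int_words_def)
  define z' where "z' = z - Poly_Mapping.single w (Poly_Mapping.lookup z w)"
  have keys_z': "words z' = words z - {w}"
    by (auto simp: z'_def in_keys_iff lookup_minus lookup_single when_def split: if_splits)
  \<comment> \<open>As \<open>w\<close> does not occur in \<open>s\<close>, the step removes exactly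
    the share of \<open>w\<close> in \<open>z\<close>.\<close>
  have lookup_w: "Poly_Mapping.lookup (s + z) w = Poly_Mapping.lookup z w"
    using w Suc.prems assms(1) by (metis IntI add_0 empty_iff in_keys_iff lookup_add subsetD)
  have "s + z' = (s + z) - of_int (Poly_Mapping.lookup (s + z) w) * (mon w - mon u * 0 * mon v)"
    unfolding lookup_w by (simp add: z'_def of_int_mult_mon)
  then have "rewrite_step {(Word [Eval, Integ], 0)} (s + z) (s + z')"
    using w lookup_w unfolding rewrite_step_def uv by (metis in_keys_iff singletonI)
  moreover have "(rewrite_step {(Word [Eval, Integ], 0)})\<^sup>*\<^sup>* (s + z') s"
    using Suc.prems Suc.hyps(2) w by (intro Suc.hyps(1)) (auto simp: keys_z')
  ultimately show ?case
    by (rule converse_rtranclp_into_rtranclp)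
qed

section \<open>Calculations modulo the coefficient relations\<close>

context integro_differential_ring
begin

interpretation coefs: expr_ideal "Idl\<^bsub>free_op_ring\<^esub> (coef_relations d)"
  by (rule expr_ideal_Idl)

notation coefs.cong (infix "\<approx>" 50)

lemma cong_coef_relation: "x - y \<in> coef_relations d \<Longrightarrow> x \<approx> y"
  using Idl_incl[of "coef_relations d"] by (auto simp: coefs.cong_def)

lemmas coef_add = cong_coef_relation[OF coef_relations.intros(1)]
lemmas coef_mult = cong_coef_relation[OF coef_relations.intros(2)]
lemmas coef_one = cong_coef_relation[OF coef_relations.intros(3)]
lemmas eval_const = cong_coef_relation[OF coef_relations.intros(6)]

text \<open>Integer factors of words have to be absorbed into ring coefficients, as terms in
  \<open>normal_terms\<close> carry none. Naturals follow by induction from additivity and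
  \<open>coef 1 \<approx> 1\<close>.\<close>

lemma coef_of_int: "coef (of_int n) \<approx> of_int n"
proof -
  \<comment> \<open>The additivity relation with both summands 0 is \<open>- coef 0\<close>.\<close>
  have zero: "coef 0 \<approx> 0"
    using coefs.uminus[OF iffD1[OF coefs.cong_def coef_add[of 0 0]]] by (simp add: coefs.cong_def)
  have nat: "coef (of_nat n) \<approx> of_nat n" for n
  proof (induction n)
    case (Suc n)
    have "coef (1 + of_nat n) \<approx> coef 1 + coef (of_nat n)"
      by (rule coef_add)
    also have "\<dots> \<approx> 1 + of_nat n"
      by (intro coefs.cong_add coef_one Suc.IH)
    finally show ?case
      by simp
  qed (simp add: zero)
  show ?thesis
  proof (cases n)
    case (nonneg k)
    then show ?thesis
      using nat by simp
  next
    case (neg k)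
    \<comment> \<open>Here \<open>n = - (k + 1)\<close>, so the left-hand side is
      \<open>coef 0\<close>.\<close>
    have "coef (of_int n + of_nat (Suc k)) \<approx> coef (of_int n) + coef (of_nat (Suc k))"
      by (rule coef_add)
    also have "\<dots> \<approx> coef (of_int n) + of_nat (Suc k)"
      by (intro coefs.cong_add nat coefs.cong_refl)
    finally have "0 \<approx> coef (of_int n) + of_nat (Suc k)"
      using coefs.cong_trans[OF coefs.cong_sym[OF zero]] neg by simp
    then show ?thesis
      using neg coefs.cong_sym[of 0] by (simp add: coefs.cong_def)
  qed
qed

lemma of_int_mult_coef: "of_int n * coef f \<approx> coef (of_int n * f)"
  by (meson coef_mult coef_of_int coefs.cong_mult coefs.cong_refl coefs.cong_sym coefs.cong_trans)

lemma opt_coef_cong: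
  assumes "c \<in> opt_coef"
  shows "\<exists>f. mon (Word c) \<approx> coef f"
proof (cases "c = []")
  case True
  then show ?thesis
    using coefs.cong_sym[OF coef_one] mon_zero by (metis zero_op_word_def)
next
  case False
  then obtain f where "mon (Word c) = coef f"
    using assms by (auto simp: opt_coef_def coef_def)
  then show ?thesis
    by (metis coefs.cong_refl)
qed

lemma scaled_opt_coef_cong:
  assumes "c \<in> opt_coef"
  shows "\<exists>f. of_int n * mon (Word c) \<approx> coef f"
proof -
  obtain f where "mon (Word c) \<approx> coef f"
    using opt_coef_cong[OF assms] by blast
  then have "of_int n * mon (Word c) \<approx> of_int n * coef f"
    by (intro coefs.cong_mult coefs.cong_refl)
  also have "\<dots> \<approx> coef (of_int n * f)"
    by (rule of_int_mult_coef)
  finally show ?thesis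
    by blast
qed

text \<open>Apply \<open>d\<close> to the decomposition of \<open>f\<close> into its evaluation and
  \<open>J (d f)\<close>; since \<open>d (J (d f)) = d f\<close>, the evaluation is differentiated
  to 0.\<close>

lemma evaluation_const: "evaluation d J f \<in> constants d"
proof -
  have "d (evaluation d J f) + d (J (d f)) = d f"
    by (simp add: evaluation_def flip: deriv_add)
  then show ?thesis
    by (simp add: constants_def deriv_int)
qed

text \<open>The integer factor goes into the leftmost coefficient. The remainder \<open>z\<close> is
  0 except for words with E\<cdot>h\<cdot>\<integral>, where it collects the part that vanishes by
  E\<cdot>\<integral> = 0.\<close>

lemma reduced_word_normal:
  assumes "reduced d J w"
  shows "\<exists>ts z. Poly_Mapping.single (Word w) n \<approx> sum_list ts + z \<and>
    set ts \<subseteq> normal_terms J \<and> words z \<subseteq> eval_int_words"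
proof -
  \<comment> \<open>Covers the three shapes that are single normal terms, with
    \<open>z = 0\<close>.\<close>
  have normal: ?thesis if "of_int n * mon (Word w) \<approx> t" "t \<in> normal_terms J" for t
    using that by (intro exI[of _ "[t]"] exI[of _ 0]) (auto simp flip: of_int_mult_mon)
  from assms show ?thesis
  proof (cases rule: reduced_cases)
    case (diff c j)
    then obtain f where f: "of_int n * mon (Word c) \<approx> coef f"
      using scaled_opt_coef_cong by metis
    have "of_int n * mon (Word c) * diff_op ^ j \<approx> coef f * diff_op ^ j"
      by (intro coefs.cong_mult f coefs.cong_refl)
    then show ?thesis
      using diff by (intro normal[OF _ normal_terms.intros(1)])
        (simp add: diff_op_power mon_mult mult.assoc)
  next
    case (int c c')
    then obtain f g where f: "of_int n * mon (Word c) \<approx> coef f" and g: "mon (Word c') \<approx> coef g"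
      using scaled_opt_coef_cong opt_coef_cong by metis
    have "of_int n * mon (Word c) * int_op * mon (Word c') \<approx> coef f * int_op * coef g"
      by (intro coefs.cong_mult f g coefs.cong_refl)
    then show ?thesis
      using int by (intro normal[OF _ normal_terms.intros(2)])
        (simp add: int_op_def mon_mult mult.assoc)
  next
    case (eval c c' j)
    then obtain f g where f: "of_int n * mon (Word c) \<approx> coef f" and g: "mon (Word c') \<approx> coef g"
      using scaled_opt_coef_cong opt_coef_cong by metis
    have "of_int n * mon (Word c) * eval_op * mon (Word c') * diff_op ^ j
        \<approx> coef f * eval_op * coef g * diff_op ^ j"
      by (intro coefs.cong_mult f g coefs.cong_refl)
    then show ?thesis
      using eval by (intro normal[OF _ normal_terms.intros(3)])
        (simp add: eval_op_def diff_op_power mon_mult mult.assoc)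
  next
    case (eval_int c h c')
    then obtain f g where f: "of_int n * mon (Word c) \<approx> coef f" and g: "mon (Word c') \<approx> coef g"
      using scaled_opt_coef_cong opt_coef_cong by metis
    \<comment> \<open>In \<open>h = J (d h) + e\<close> the first summand lies in
      \<open>range J\<close> and yields the normal term \<open>t\<close>; the constant
      \<open>e\<close> yields \<open>z\<close>, written with \<open>e\<close> already moved to the
      left of E.\<close>
    define e where "e = evaluation d J h"
    define t where "t = coef f * eval_op * coef (J (d h)) * int_op * coef g"
    define z where "z = coef f * (coef e * eval_op) * int_op * coef g"
    have h: "coef h \<approx> coef (J (d h)) + coef e"
      using coef_add[of "J (d h)" e] by (simp add: e_def evaluation_def)
    have "of_int n * mon (Word c) * eval_op * coef h * int_op * mon (Word c')
        \<approx> coef f * eval_op * (coef (J (d h)) + coef e) * int_op * coef g"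
      by (intro coefs.cong_mult f g h coefs.cong_refl)
    also have "\<dots> = t + coef f * (eval_op * coef e) * int_op * coef g"
      by (simp add: t_def algebra_simps)
    also have "\<dots> \<approx> t + z"
      unfolding z_def e_def
      by (intro coefs.cong_add coefs.cong_mult eval_const evaluation_const coefs.cong_refl)
    finally have "Poly_Mapping.single (Word w) n \<approx> sum_list [t] + z"
      using eval_int by (simp add: op_defs mon_mult mult.assoc flip: of_int_mult_mon)
    moreover have "t \<in> normal_terms J"
      unfolding t_def by (intro normal_terms.intros) simp
    moreover have "Word [Coef f, Coef e, Eval, Integ, Coef g] \<in> eval_int_words"
      unfolding Word_eval_int_words_iff by (rule exI[of _ "[Coef f, Coef e]"]) simp
    then have "words z \<subseteq> eval_int_words"
      by (simp add: z_def op_defs mon_mult keys_mon)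
    ultimately show ?thesis
      by (metis empty_set empty_subsetI insert_subset list.simps(15))
  qed
qed

text \<open>Treat the words of the expression one by one, concatenating the lists of normal terms
  and adding the remainders.\<close>

lemma reduced_expr_normal:
  assumes "\<And>w. Word w \<in> words y \<Longrightarrow> reduced d J w"
  shows "\<exists>ts z. y \<approx> sum_list ts + z \<and> set ts \<subseteq> normal_terms J \<and> words z \<subseteq> eval_int_words"
proof -
  have sum_words: "(\<Sum>w\<in>words y. Poly_Mapping.single w (Poly_Mapping.lookup y w)) = y"
    by (rule poly_mapping_eqI) (simp add: lookup_sum lookup_single when_def
        not_in_keys_iff_lookup_eq_zero del: lookup_not_eq_zero_eq_in_keys)
  have "\<exists>ts z. (\<Sum>w\<in>A. Poly_Mapping.single w (Poly_Mapping.lookup y w)) \<approx> sum_list ts + z \<and>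
      set ts \<subseteq> normal_terms J \<and> words z \<subseteq> eval_int_words"
    if "finite A" "A \<subseteq> words y" for A
    using that
  proof induction
    case empty
    show ?case
      by (intro exI[of _ "[]"] exI[of _ 0]) simp
  next
    case (insert a A)
    have "A \<subseteq> words y" and "a \<in> words y"
      using insert.prems by simp_all
    from insert.IH[OF this(1)] obtain ts z where
      A: "(\<Sum>w\<in>A. Poly_Mapping.single w (Poly_Mapping.lookup y w)) \<approx> sum_list ts + z"
        "set ts \<subseteq> normal_terms J" "words z \<subseteq> eval_int_words"
      by blast
    obtain w where w: "a = Word w"
      by (cases a)
    with \<open>a \<in> words y\<close> have "reduced d J w"
      by (intro assms) simp
    from reduced_word_normal[OF this] obtain ts' z' where
      a: "Poly_Mapping.single a (Poly_Mapping.lookup y a) \<approx> sum_list ts' + z'"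
        "set ts' \<subseteq> normal_terms J" "words z' \<subseteq> eval_int_words"
      unfolding w by blast
    have "(\<Sum>w\<in>insert a A. Poly_Mapping.single w (Poly_Mapping.lookup y w))
        = Poly_Mapping.single a (Poly_Mapping.lookup y a)
          + (\<Sum>w\<in>A. Poly_Mapping.single w (Poly_Mapping.lookup y w))"
      by (rule sum.insert[OF insert.hyps])
    also have "\<dots> \<approx> sum_list ts' + z' + (sum_list ts + z)"
      by (rule coefs.cong_add[OF a(1) A(1)])
    also have "\<dots> = sum_list (ts' @ ts) + (z' + z)"
      by (simp add: add_ac)
    finally have "(\<Sum>w\<in>insert a A. Poly_Mapping.single w (Poly_Mapping.lookup y w))
        \<approx> sum_list (ts' @ ts) + (z' + z)" .
    moreover have "words (z' + z) \<subseteq> eval_int_words"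
      using keys_add[of z' z] a(3) A(3) by (rule order_trans[OF _ Un_least])
    moreover have "set (ts' @ ts) \<subseteq> normal_terms J"
      using a(2) A(2) by simp
    ultimately show ?case
      by blast
  qed
  from this[OF finite_keys subset_refl] show ?thesis
    by (simp only: sum_words)
qed

end

text \<open>The intermediate \<open>y'\<close> is there because an irreducible word may contain
  E\<cdot>h\<cdot>\<integral> with \<open>h\<close> outside \<open>range J\<close>: splitting
  \<open>h\<close> is a calculation with coefficients, after which the rule E\<cdot>\<integral> = 0
  applies once more.\<close>

theorem theorem4p2:
  fixes d J :: "'a::ring_1 \<Rightarrow> 'a"
  assumes "integro_differential_ring d J"
  shows "\<forall>T \<in> carrier (ido_ring d J).
    (\<exists>ts. set ts \<subseteq> normal_terms J \<and> ido_class d J (sum_list ts) = T) \<and>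
    (\<forall>x. ido_class d J x = T \<longrightarrow>
      (\<nexists>s :: nat \<Rightarrow> 'a op_expr. s 0 = x \<and>
        (\<forall>n. rewrite_step (op_rules d J \<union> coef_rules) (s n) (s (Suc n)))) \<and>
      (\<forall>y. (rewrite_step (op_rules d J \<union> coef_rules))\<^sup>*\<^sup>* x y \<and>
           irreducible_expr (op_rules d J \<union> coef_rules) y \<longrightarrow>
        (\<exists>y' ts. coef_equal d y y' \<and>
           (rewrite_step {(Word [Eval, Integ], 0)})\<^sup>*\<^sup>* y' (sum_list ts) \<and>
           set ts \<subseteq> normal_terms J \<and>
           ido_class d J (sum_list ts) = T)))"
proof -
  interpret integro_differential_ring d J
    by (rule assms)
  interpret ido: expr_ideal "ido_ideal d J"
    unfolding ido_ideal_def by (rule expr_ideal_Idl)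
  interpret coefs: expr_ideal "Idl\<^bsub>free_op_ring\<^esub> (coef_relations d)"
    by (rule expr_ideal_Idl)
  let ?S = "op_rules d J \<union> coef_rules"
  have terminating: "\<nexists>s. s 0 = x \<and> (\<forall>n. rewrite_step ?S (s n) (s (Suc n)))" for x
    using wf_rewrite_step[OF decreasing_rules, of d J] unfolding wf_iff_no_infinite_down_chain
    by blast
  have normal: "\<exists>y' ts. coef_equal d y y' \<and>
      (rewrite_step {(Word [Eval, Integ], 0)})\<^sup>*\<^sup>* y' (sum_list ts) \<and>
      set ts \<subseteq> normal_terms J \<and> ido_class d J (sum_list ts) = ido_class d J x"
    if steps: "(rewrite_step ?S)\<^sup>*\<^sup>* x y" and irred: "irreducible_expr ?S y" for x y
  proof -
    obtain ts z where y: "coefs.cong y (sum_list ts + z)"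
      and ts: "set ts \<subseteq> normal_terms J" and z: "words z \<subseteq> eval_int_words"
      using reduced_expr_normal irreducible_exprD[OF irred] by blast
    have rewrite: "(rewrite_step {(Word [Eval, Integ], 0)})\<^sup>*\<^sup>* (sum_list ts + z) (sum_list ts)"
      by (intro rewrite_eval_int keys_sum_list_normal_terms[OF ts] z)
    \<comment> \<open>The operator is preserved in three stages: by the rules, by coefficient
      calculations, and by the final uses of E\<cdot>\<integral> = 0.\<close>
    have "ido.cong x y"
      using steps by (rule ido.rewrite_steps_cong)
        (auto simp: ido.cong_def op_rules_ido coef_rules_ido)
    also have "ido.cong y (sum_list ts + z)"
      using y coef_ideal_ido by (auto simp: ido.cong_def coefs.cong_def)
    also have "ido.cong \<dots> (sum_list ts)"
      using rewrite by (rule ido.rewrite_steps_cong)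
        (auto simp: ido.cong_def intro: op_rules_ido[OF eval_int, simplified])
    finally have "ido_class d J (sum_list ts) = ido_class d J x"
      unfolding ido_class_def using ido.rcoset_eq by simp
    moreover have "coef_equal d y (sum_list ts + z)"
      using y by (simp add: coef_equal_def coefs.cong_def)
    ultimately show ?thesis
      using rewrite ts by blast
  qed
  \<comment> \<open>Termination supplies an irreducible result for every expression, to which
    \<open>normal\<close> applies.\<close>
  have represented: "\<exists>ts. set ts \<subseteq> normal_terms J \<and> ido_class d J (sum_list ts) = ido_class d J x"
    for x
  proof -
    obtain y where "(rewrite_step ?S)\<^sup>*\<^sup>* x y" "irreducible_expr ?S y"
      using rewrite_normal_form[OF decreasing_rules] by blast
    from normal[OF this] show ?thesis
      by blast
  qed
  show ?thesis
  proof (intro ballI conjI allI impI)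
    fix T assume "T \<in> carrier (ido_ring d J)"
    then obtain x where "T = ido_class d J x"
      by (auto simp: ido_ring_def FactRing_def A_RCOSETS_def' ido_class_def)
    then show "\<exists>ts. set ts \<subseteq> normal_terms J \<and> ido_class d J (sum_list ts) = T"
      using represented by simp
  next
    fix x
    show "\<nexists>s. s 0 = x \<and> (\<forall>n. rewrite_step ?S (s n) (s (Suc n)))"
      by (rule terminating)
  next
    fix T x y
    assume T: "ido_class d J x = T" and "(rewrite_step ?S)\<^sup>*\<^sup>* x y \<and> irreducible_expr ?S y"
    then show "\<exists>y' ts. coef_equal d y y' \<and>
        (rewrite_step {(Word [Eval, Integ], 0)})\<^sup>*\<^sup>* y' (sum_list ts) \<and>
        set ts \<subseteq> normal_terms J \<and> ido_class d J (sum_list ts) = T"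
      using normal[of x y] unfolding T by blast
  qed
qed

end
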